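(* Let $\lambda,\nu>0$. For $W\in\mathbb{R}$ consider the single-content average latency problem $$\min_{\pi}\ \limsup_{T\to\infty}\frac1T\,\mathbb{E}_{\pi}\left[\int_0^T\big(S_t-W(1-A_t)\big)\,dt\right],$$ for the controlled continuous-time Markov process $(S_t)$ on $\{0,1,\dots,S_{max}\}$ with actions $A_t\in\{0,1\}$, where in state $s$ under action $a$ the process jumps to $s+1$ at rate $\lambda$ (if $s<S_{max}$) and to $s-1$ at rate $\nu s a$. Let $D(W)$ be the set of states in which the passive action $a=0$ is optimal. Then this problem is indexable: if $W>W'$, then $D(W)\supseteq D(W')$.
   Context: The state is the number of outstanding requests for a content; $a=1$ (active) means the content is cached, $a=0$ (passive) means it is not. $W$ is a Lagrange multiplier. The state is assumed to be bounded by $S_{max}$, which can be arbitrarily large but finite. An action is optimal in state $s$ if it attains the minimum in the average-cost dynamic programming equation $$\beta=\min_{a\in\{0,1\}}\Big\{s-W(1-a)+\lambda\mathbf{1}_{\{s<S_{max}\}}\big(V(s+1)-V(s)\big)+\nu s a\big(V(s-1)-V(s)\big)\Big\},\quad s=0,\dots,S_{max},$$ where $\beta$ is the optimal average cost and $V$ the relative value function. *)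

theory Defs
  imports "HOL-Probability.Probability"
begin

text \<open>
  The expected instantaneous change of \<open>f\<close> in state \<open>s\<close> under action \<open>a\<close>.  At \<open>s = 0\<close> the second
  term vanishes, so truncated subtraction in \<open>s - 1\<close> is harmless.
\<close>

definition generator ::
    "real \<Rightarrow> real \<Rightarrow> nat \<Rightarrow> (nat \<Rightarrow> real) \<Rightarrow> nat \<Rightarrow> nat \<Rightarrow> real" where
  "generator lam nu Smax f a s =
     lam * (if s < Smax then 1 else 0) * (f (s + 1) - f s)
     + nu * real s * real a * (f (s - 1) - f s)"

definition latency_cost :: "real \<Rightarrow> nat \<Rightarrow> nat \<Rightarrow> real" where
  "latency_cost W a s = real s - W * (1 - real a)"

definition progressively_measurable ::
    "(real \<Rightarrow> 'w measure) \<Rightarrow> (real \<Rightarrow> 'w \<Rightarrow> nat) \<Rightarrow> bool" where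
  "progressively_measurable F X \<longleftrightarrow>
     (\<forall>T\<ge>0. (\<lambda>(t, w). X t w)
        \<in> measurable (restrict_space borel {0..T} \<Otimes>\<^sub>M F T) (count_space UNIV))"

definition cadlag_paths :: "'w set \<Rightarrow> (real \<Rightarrow> 'w \<Rightarrow> nat) \<Rightarrow> bool" where
  "cadlag_paths \<Omega> X \<longleftrightarrow>
     (\<forall>w\<in>\<Omega>. (\<forall>t\<ge>0. \<forall>\<^sub>F u in at_right t. X u w = X t w)
           \<and> (\<forall>t>0. \<exists>k. \<forall>\<^sub>F u in at_left t. X u w = k))"

text \<open>
  A policy together with the process it controls from the initial state \<open>s0\<close>.  The action process
  \<open>A\<close> may depend on the past and on extra randomisation, through any filtration \<open>F\<close> for which \<open>S\<close>
  has the prescribed jump rates.  The rates are imposed by the controlled martingale problem: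
  for every \<open>f\<close>, \<open>f (S t) - (\<integral>u\<in>{0..t}. generator f (A u) (S u))\<close> is an \<open>F\<close>-martingale.
\<close>

definition controlled_process ::
    "real \<Rightarrow> real \<Rightarrow> nat \<Rightarrow> nat \<Rightarrow> 'w measure \<Rightarrow> (real \<Rightarrow> 'w measure)
      \<Rightarrow> (real \<Rightarrow> 'w \<Rightarrow> nat) \<Rightarrow> (real \<Rightarrow> 'w \<Rightarrow> nat) \<Rightarrow> bool" where
  "controlled_process lam nu Smax s0 M F S A \<longleftrightarrow>
     prob_space M
     \<and> filtration (space M) F
     \<and> (\<forall>t. subalgebra M (F t))
     \<and> progressively_measurable F S
     \<and> progressively_measurable F A
     \<and> cadlag_paths (space M) S
     \<and> (\<forall>w\<in>space M. \<forall>t\<ge>0. S t w \<in> {0..Smax} \<and> A t w \<in> {0, 1})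
     \<and> (\<forall>w\<in>space M. S 0 w = s0)
     \<and> (\<forall>f :: nat \<Rightarrow> real. \<forall>r\<ge>0. \<forall>t\<ge>r.
          AE w in M. real_cond_exp M (F r)
            (\<lambda>w. f (S t w) - f (S r w)
                 - (LBINT u:{r..t}. generator lam nu Smax f (A u w) (S u w))) w = 0)"

definition average_cost ::
    "real \<Rightarrow> 'w measure \<Rightarrow> (real \<Rightarrow> 'w \<Rightarrow> nat) \<Rightarrow> (real \<Rightarrow> 'w \<Rightarrow> nat) \<Rightarrow> ereal" where
  "average_cost W M S A =
     Limsup at_top (\<lambda>T. ereal (1 / T *
       (\<integral>w. (LBINT t:{0..T}. latency_cost W (A t w) (S t w)) \<partial>M)))"

text \<open>
  HOL cannot quantify over the type of the sample space.  The type of real sequences is large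
  enough to carry all the randomness needed (for instance i.i.d. uniform variables), and both the
  \<open>\<sigma>\<close>-algebra and the set of outcomes remain arbitrary.
\<close>

definition optimal_average_cost ::
    "real \<Rightarrow> real \<Rightarrow> nat \<Rightarrow> real \<Rightarrow> nat \<Rightarrow> ereal" where
  "optimal_average_cost lam nu Smax W s0 =
     Inf {average_cost W M S A | (M :: (nat \<Rightarrow> real) measure) F S A.
            controlled_process lam nu Smax s0 M F S A}"

definition dp_term ::
    "real \<Rightarrow> real \<Rightarrow> nat \<Rightarrow> real \<Rightarrow> (nat \<Rightarrow> real) \<Rightarrow> nat \<Rightarrow> nat \<Rightarrow> real" where
  "dp_term lam nu Smax W V s a = latency_cost W a s + generator lam nu Smax V a s"

text \<open>
  \<open>V\<close> solves the average-cost dynamic programming equation in which \<open>\<beta>\<close> is the optimal average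
  cost, which does not depend on the initial state.
\<close>

definition relative_value_function ::
    "real \<Rightarrow> real \<Rightarrow> nat \<Rightarrow> real \<Rightarrow> (nat \<Rightarrow> real) \<Rightarrow> bool" where
  "relative_value_function lam nu Smax W V \<longleftrightarrow>
     (\<exists>\<beta>::real.
        (\<forall>s0\<le>Smax. optimal_average_cost lam nu Smax W s0 = ereal \<beta>)
        \<and> (\<forall>s\<le>Smax. \<beta> = (MIN a\<in>{0, 1}. dp_term lam nu Smax W V s a)))"

definition optimal_action ::
    "real \<Rightarrow> real \<Rightarrow> nat \<Rightarrow> real \<Rightarrow> (nat \<Rightarrow> real) \<Rightarrow> nat \<Rightarrow> nat \<Rightarrow> bool" where
  "optimal_action lam nu Smax W V s a \<longleftrightarrow>
     a \<in> {0, 1} \<and>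
     dp_term lam nu Smax W V s a = (MIN a'\<in>{0, 1}. dp_term lam nu Smax W V s a')"

definition passive_states ::
    "real \<Rightarrow> real \<Rightarrow> nat \<Rightarrow> real \<Rightarrow> (nat \<Rightarrow> real) \<Rightarrow> nat set" where
  "passive_states lam nu Smax W V = {s \<in> {0..Smax}. optimal_action lam nu Smax W V s 0}"

end

theory Submission
  imports Defs
begin

text \<open>
  Let \<open>y s = \<nu> s (V s - V (s - 1)) - W\<close> be the advantage of the active action, so that \<open>s\<close> is
  passive iff \<open>y s \<le> 0\<close>, and put \<open>g = \<beta> + W\<close>.  The dynamic programming equation becomes the
  recursion \<open>y (s + 1) = c s (g - s + max 0 (y s)) - W\<close> with the increasing coefficients
  \<open>c s = \<nu> (s + 1) / \<lambda>\<close>, started at \<open>y 0 = - W\<close> and closed by \<open>g + max 0 (y Smax) = Smax\<close>.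
  We claim that \<open>y\<close> decreases pointwise when \<open>W\<close> grows.  Let \<open>P\<close> be the increment of \<open>g\<close> and suppose
  that \<open>s + 1\<close> is the first state where \<open>y\<close> increases.  As \<open>y s\<close> does not increase, \<open>c s P\<close> exceeds
  the increment of \<open>W\<close>, so \<open>P > 0\<close>, and since \<open>c\<close> is increasing, \<open>y\<close> increases at all later states
  as well.  Then \<open>g + max 0 (y Smax)\<close> grows by at least \<open>P > 0\<close>, although it is constant.
\<close>

lemma recursion_antimono:
  fixes c y y' :: "nat \<Rightarrow> real" and g g' W W' :: real
  assumes c: "mono c" "\<And>s. c s \<ge> 0"
    and W: "W' < W"
    and init: "y 0 \<le> y' 0"
    and step: "\<And>s. s < N \<Longrightarrow> y (Suc s) = c s * (g - real s + max 0 (y s)) - W"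
    and step': "\<And>s. s < N \<Longrightarrow> y' (Suc s) = c s * (g' - real s + max 0 (y' s)) - W'"
    and final: "g + max 0 (y N) = g' + max 0 (y' N)"
    and "s \<le> N"
  shows "y s \<le> y' s"
proof (rule ccontr)
  assume "\<not> y s \<le> y' s"
  define k where "k = (LEAST k. \<not> y k \<le> y' k)"
  have k: "\<not> y k \<le> y' k"
    unfolding k_def by (rule LeastI) (fact \<open>\<not> y s \<le> y' s\<close>)
  have least: "y j \<le> y' j" if "j < k" for j
    using not_less_Least[OF that[unfolded k_def]] by simp
  have "k \<le> N"
    unfolding k_def using \<open>\<not> y s \<le> y' s\<close> \<open>s \<le> N\<close> by (meson Least_le order_trans)
  obtain m where m: "k = Suc m"
    using k init by (cases k) auto
  have diff: "y (Suc j) - y' (Suc j) = c j * (g - g' + (max 0 (y j) - max 0 (y' j))) - (W - W')"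
    if "j < N" for j
    using step[OF that] step'[OF that] by (simp add: algebra_simps)
  have "W - W' < c m * (g - g' + (max 0 (y m) - max 0 (y' m)))"
    using diff[of m] k m \<open>k \<le> N\<close> by simp
  also have "\<dots> \<le> c m * (g - g')"
    using least[of m] m c(2) by (intro mult_left_mono) auto
  finally have P: "W - W' < c m * (g - g')" .
  then have "g - g' > 0"
    using W c(2)[of m] by (smt (verit) mult_nonneg_nonpos)
  have "y j \<ge> y' j" if "k \<le> j" "j \<le> N" for j
    using that
  proof (induction j rule: dec_induct)
    case base
    show ?case using k by simp
  next
    case (step j)
    \<comment> \<open>By the induction hypothesis the difference of maxima is nonnegative, so the
      second factor is at least \<open>g - g' > 0\<close>.\<close>
    have "c m * (g - g') \<le> c j * (g - g' + (max 0 (y j) - max 0 (y' j)))"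
      using monoD[OF c(1), of m j] step m \<open>g - g' > 0\<close> c(2) by (intro mult_mono) auto
    then show ?case
      using diff[of j] P step.prems by simp
  qed
  from this[OF \<open>k \<le> N\<close>] show False
    using final \<open>g - g' > 0\<close> by simp
qed

definition active_advantage :: "real \<Rightarrow> real \<Rightarrow> (nat \<Rightarrow> real) \<Rightarrow> nat \<Rightarrow> real" where
  "active_advantage nu W V s = nu * real s * (V s - V (s - 1)) - W"

lemma dp_term_active:
  "dp_term lam nu Smax W V s 1 = dp_term lam nu Smax W V s 0 - active_advantage nu W V s"
  by (simp add: dp_term_def latency_cost_def generator_def active_advantage_def algebra_simps)

lemma Min_dp_term:
  "(MIN a\<in>{0, 1}. dp_term lam nu Smax W V s a)
     = dp_term lam nu Smax W V s 0 - max 0 (active_advantage nu W V s)"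
  using dp_term_active[of lam nu Smax W V s] by simp

lemma passive_states_iff:
  "s \<in> passive_states lam nu Smax W V \<longleftrightarrow> s \<le> Smax \<and> active_advantage nu W V s \<le> 0"
  unfolding passive_states_def optimal_action_def Min_dp_term by auto

text \<open>For \<open>s < Smax\<close> the equation is solved for \<open>V (Suc s) - V s\<close>;
  at \<open>Smax\<close> the arrival term vanishes, which leaves the closing condition.\<close>

lemma relative_value_function_recursion:
  assumes "lam > 0" and "relative_value_function lam nu Smax W V"
  obtains g where
    "\<And>s. s < Smax \<Longrightarrow> active_advantage nu W V (Suc s)
       = nu * real (Suc s) / lam * (g - real s + max 0 (active_advantage nu W V s)) - W"
    and "g + max 0 (active_advantage nu W V Smax) = real Smax"
proof -
  obtain \<beta> where \<beta>: "\<And>s. s \<le> Smax \<Longrightarrow>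
      \<beta> = dp_term lam nu Smax W V s 0 - max 0 (active_advantage nu W V s)"
    using assms(2) unfolding relative_value_function_def Min_dp_term by blast
  show thesis
  proof (rule that[of "\<beta> + W"])
    fix s assume "s < Smax"
    then have "\<beta> + W - real s + max 0 (active_advantage nu W V s) = lam * (V (Suc s) - V s)"
      using \<beta>[of s] by (simp add: dp_term_def latency_cost_def generator_def)
    then show "active_advantage nu W V (Suc s)
       = nu * real (Suc s) / lam * (\<beta> + W - real s + max 0 (active_advantage nu W V s)) - W"
      using assms(1) by (simp add: active_advantage_def)
  next
    show "\<beta> + W + max 0 (active_advantage nu W V Smax) = real Smax"
      using \<beta>[of Smax] by (simp add: dp_term_def latency_cost_def generator_def)
  qed
qed

theorem proposition3:
  fixes lam nu W W' :: real and Smax :: nat and V V' :: "nat \<Rightarrow> real"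
  assumes "lam > 0" and "nu > 0"
    and "relative_value_function lam nu Smax W V"
    and "relative_value_function lam nu Smax W' V'"
    and "W > W'"
  shows "passive_states lam nu Smax W V \<supseteq> passive_states lam nu Smax W' V'"
proof -
  let ?c = "\<lambda>s. nu * real (Suc s) / lam"
  obtain g where g:
    "\<And>s. s < Smax \<Longrightarrow> active_advantage nu W V (Suc s)
       = ?c s * (g - real s + max 0 (active_advantage nu W V s)) - W"
    "g + max 0 (active_advantage nu W V Smax) = real Smax"
    using relative_value_function_recursion[OF assms(1,3)] by blast
  obtain g' where g':
    "\<And>s. s < Smax \<Longrightarrow> active_advantage nu W' V' (Suc s)
       = ?c s * (g' - real s + max 0 (active_advantage nu W' V' s)) - W'"
    "g' + max 0 (active_advantage nu W' V' Smax) = real Smax"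
    using relative_value_function_recursion[OF assms(1,4)] by blast
  have "mono ?c"
    using assms(1,2) by (intro monoI divide_right_mono mult_left_mono) auto
  moreover have "?c s \<ge> 0" for s
    using assms(1,2) by simp
  \<comment> \<open>The factor \<open>real s\<close> vanishes at 0, so the two sides are
    \<open>- W\<close> and \<open>- W'\<close> whatever \<open>V\<close> and \<open>V'\<close>
    are.\<close>
  moreover have "active_advantage nu W V 0 \<le> active_advantage nu W' V' 0"
    using assms(5) by (simp add: active_advantage_def)
  ultimately have "active_advantage nu W V s \<le> active_advantage nu W' V' s" if "s \<le> Smax" for s
    using recursion_antimono[of ?c W' W, OF _ _ assms(5) _ g(1) g'(1) _ that] g(2) g'(2) by simp
  then show ?thesis
    by (fastforce simp: passive_states_iff)
qed

end
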